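(* Let $T>0$ and let $H\colon\mathbb{R}\times\mathbb{R}^2\to\mathbb{R}$, $H=H(t,z)$, satisfy the following. (H0) $H$ is continuously differentiable in $z$, and $F(t,z):=J\nabla_zH(t,z)$ satisfies: $F$ satisfies the Carathéodory conditions and is $T$-periodic in $t$; for every $(\bar t,\bar z)\in\mathbb{R}\times\mathbb{R}^2$ the solution of $\dot z=F(t,z)$, $z(\bar t)=\bar z$ is unique; for every $\bar t\in[0,T]$ the solution of $\dot z=F(t,z)$, $z(\bar t)=0_{\mathbb{R}^2}$ can be continued to the whole interval $[0,T]$. (H1) There exist $\mathfrak r>0$, $c>0$ and $\gamma\ge1$ such that for a.e. $t\in[0,T]$ and every $\theta\in[0,2\pi)$, $\rho\ge\mathfrak r$, $$\frac{\partial H(t,\theta,\rho)}{\partial\rho}\ge c\left|\frac{\partial H(t,\theta,\rho)}{\partial\theta}\right|^{\gamma}.$$ Then, for every $z_0\in\mathbb{R}^2$ such that the solution of $\dot z=J\nabla_zH(t,z)$, $z(0)=z_0$ blows up at a finite time $T_{\mathrm F}\in(0,T]$, we have $\lim_{t\to T_{\mathrm F}^-}\mathrm{rot}_t(z_0)=+\infty$.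
   Context: $|\cdot|$ and $\langle\cdot,\cdot\rangle$ are the Euclidean norm and scalar product on $\mathbb{R}^2$; $J=\begin{pmatrix}0&1\\-1&0\end{pmatrix}$. $H(t,\theta,\rho)$ denotes $H$ expressed in clockwise canonical polar coordinates: $H(t,\theta,\rho)=H\bigl(t,(\sqrt{2\rho}\cos\theta,-\sqrt{2\rho}\sin\theta)\bigr)$, so $|z|=\sqrt{2\rho}$. Carathéodory conditions for $F$: for every $z$ the map $t\mapsto F(t,z)$ is measurable; for a.e. $t$ the map $z\mapsto F(t,z)$ is continuous; for every compact $[a,b]\times K\subset\mathbb{R}\times\mathbb{R}^2$ there is $m_K\in L^1([a,b])$ with $|F(t,z)|\le m_K(t)$ for a.e. $t\in[a,b]$ and every $z\in K$. Solutions are understood in the Carathéodory sense (absolutely continuous functions satisfying the equation a.e.). The solution $z(t)$ with $z(0)=z_0$ blows up at a finite time $T_{\mathrm F}$ if its maximal interval of existence to the right of $0$ is $[0,T_{\mathrm F})$. Clockwise rotation: if the solution $z(\cdot)$ with $z(0)=z_0$ exists on $[0,t]$ and does not vanish there, $$\mathrm{rot}_t(z_0)=\frac1{2\pi}\int_0^t\frac{\langle F(s,z(s)),Jz(s)\rangle}{|z(s)|^2}\,ds .$$ (Under (H0), a solution with $z(0)=z_0$ blowing up at $T_{\mathrm F}\in(0,T]$ does not vanish on $[0,T_{\mathrm F})$.) *)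

theory Defs
  imports "HOL-Analysis.Analysis"
begin

definition J :: "real^2^2" where
  "J = vector [vector [0, 1], vector [-1, 0]]"

text \<open>Only meaningful where \<open>f\<close> is differentiable, since \<open>THE\<close> is unspecified elsewhere.\<close>

definition grad :: "('a::real_inner \<Rightarrow> real) \<Rightarrow> 'a \<Rightarrow> 'a" where
  "grad f z = (THE D. GDERIV f z :> D)"

definition C1 :: "('a::real_inner \<Rightarrow> real) \<Rightarrow> bool" where
  "C1 f \<longleftrightarrow> (\<forall>z. f differentiable (at z)) \<and> continuous_on UNIV (grad f)"

definition hamiltonian_field :: "(real \<Rightarrow> real^2 \<Rightarrow> real) \<Rightarrow> real \<Rightarrow> real^2 \<Rightarrow> real^2" where
  "hamiltonian_field H t z = J *v grad (H t) z"

text \<open>Clockwise canonical polar coordinates; \<open>\<rho>\<close> is half of the squared norm, not the radius.\<close>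

definition polar :: "real \<Rightarrow> real \<Rightarrow> real^2" where
  "polar \<theta> \<rho> = vector [sqrt (2 * \<rho>) * cos \<theta>, - sqrt (2 * \<rho>) * sin \<theta>]"

definition caratheodory :: "(real \<Rightarrow> real^2 \<Rightarrow> real^2) \<Rightarrow> bool" where
  "caratheodory F \<longleftrightarrow>
     (\<forall>z. (\<lambda>t. F t z) \<in> borel_measurable lebesgue) \<and>
     (AE t in lebesgue. continuous_on UNIV (F t)) \<and>
     (\<forall>a b K. compact K \<longrightarrow>
        (\<exists>m. set_integrable lebesgue {a..b} m \<and>
             (AE t in lebesgue. t \<in> {a..b} \<longrightarrow> (\<forall>z\<in>K. norm (F t z) \<le> m t))))"

text \<open>
  The usual epsilon-delta definition. A finite family of non-overlapping compact
  intervals contained in \<open>S\<close> is a division of some subset \<open>U\<close> of \<open>S\<close>; the endpoints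
  of a member \<open>k\<close> are \<open>Inf k\<close> and \<open>Sup k\<close>.
\<close>

definition absolutely_continuous_on :: "real set \<Rightarrow> (real \<Rightarrow> 'a::real_normed_vector) \<Rightarrow> bool" where
  "absolutely_continuous_on S f \<longleftrightarrow>
     (\<forall>\<epsilon>>0. \<exists>\<delta>>0. \<forall>D U. D division_of U \<and> U \<subseteq> S \<and> (\<Sum>k\<in>D. Sup k - Inf k) < \<delta> \<longrightarrow>
        (\<Sum>k\<in>D. norm (f (Sup k) - f (Inf k))) < \<epsilon>)"

text \<open>
  On an interval that is not compact, absolute continuity is required on each compact
  subinterval; solutions that blow up are not absolutely continuous up to the end point.
\<close>

definition caratheodory_solution ::
    "(real \<Rightarrow> real^2 \<Rightarrow> real^2) \<Rightarrow> real set \<Rightarrow> (real \<Rightarrow> real^2) \<Rightarrow> bool" where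
  "caratheodory_solution F I z \<longleftrightarrow>
     is_interval I \<and>
     (\<forall>a b. {a..b} \<subseteq> I \<longrightarrow> absolutely_continuous_on {a..b} z) \<and>
     (AE t in lebesgue. t \<in> I \<longrightarrow> (z has_vector_derivative F t (z t)) (at t within I))"

definition unique_solutions :: "(real \<Rightarrow> real^2 \<Rightarrow> real^2) \<Rightarrow> bool" where
  "unique_solutions F \<longleftrightarrow>
     (\<forall>tbar zbar I z w. tbar \<in> I \<and>
        caratheodory_solution F I z \<and> z tbar = zbar \<and>
        caratheodory_solution F I w \<and> w tbar = zbar \<longrightarrow> (\<forall>t\<in>I. z t = w t))"

definition hypothesis_H0 :: "real \<Rightarrow> (real \<Rightarrow> real^2 \<Rightarrow> real) \<Rightarrow> bool" where
  "hypothesis_H0 T H \<longleftrightarrow>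
     (\<forall>t. C1 (H t)) \<and>
     caratheodory (hamiltonian_field H) \<and>
     (\<forall>t z. hamiltonian_field H (t + T) z = hamiltonian_field H t z) \<and>
     unique_solutions (hamiltonian_field H) \<and>
     (\<forall>tbar\<in>{0..T}. \<exists>z. caratheodory_solution (hamiltonian_field H) {0..T} z \<and> z tbar = 0)"

definition hypothesis_H1 :: "real \<Rightarrow> (real \<Rightarrow> real^2 \<Rightarrow> real) \<Rightarrow> bool" where
  "hypothesis_H1 T H \<longleftrightarrow>
     (\<exists>r>0. \<exists>c>0. \<exists>\<gamma>\<ge>1. AE t in lebesgue. t \<in> {0..T} \<longrightarrow>
        (\<forall>\<theta> \<rho>. 0 \<le> \<theta> \<and> \<theta> < 2 * pi \<and> r \<le> \<rho> \<longrightarrow>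
           deriv (\<lambda>\<rho>'. H t (polar \<theta> \<rho>')) \<rho>
             \<ge> c * \<bar>deriv (\<lambda>\<theta>'. H t (polar \<theta>' \<rho>)) \<theta>\<bar> powr \<gamma>))"

definition blows_up_at ::
    "(real \<Rightarrow> real^2 \<Rightarrow> real^2) \<Rightarrow> (real \<Rightarrow> real^2) \<Rightarrow> real \<Rightarrow> bool" where
  "blows_up_at F z TF \<longleftrightarrow>
     0 < TF \<and> caratheodory_solution F {0..<TF} z \<and>
     \<not> (\<exists>I w. {0..<TF} \<subset> I \<and> I \<subseteq> {0..} \<and> caratheodory_solution F I w \<and>
             (\<forall>t\<in>{0..<TF}. w t = z t))"

text \<open>
  The clockwise rotation on \<open>{0..t}\<close> of the trajectory \<open>z\<close>; it is meaningful only if \<open>z\<close>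
  solves the equation and does not vanish there (division by zero yields zero).
\<close>

definition rot :: "(real \<Rightarrow> real^2 \<Rightarrow> real^2) \<Rightarrow> (real \<Rightarrow> real^2) \<Rightarrow> real \<Rightarrow> real" where
  "rot F z t = 1 / (2 * pi) *
     (LINT s:{0..t}|lebesgue. (F s (z s) \<bullet> (J *v z s)) / (norm (z s))\<^sup>2)"

end

theory Submission
  imports Defs
begin

text \<open>
  Write \<open>\<rho> = \<bar>z\<bar>\<^sup>2/2\<close>. Along a solution the integrand of the rotation is \<open>\<partial>H/\<partial>\<rho>\<close> and \<open>\<rho>' = - \<partial>H/\<partial>\<theta>\<close>,
  so where \<open>\<rho>\<close> is large (H1) bounds the integrand below by \<open>c \<bar>\<rho>'\<bar> powr \<gamma> \<ge> c (\<rho>' - 1)\<close>, and the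
  rotation on \<open>[s, t]\<close> is at least \<open>c (\<rho>(t) - \<rho>(s) - (t - s)) / (2 \<pi>)\<close>. A blowing-up solution satisfies
  \<open>\<bar>z(t)\<bar> \<rightarrow> \<infinity>\<close>: near the end point the integral of a dominating function is too small for
  climbing from \<open>\<bar>z\<bar> \<le> R\<close> to \<open>\<bar>z\<bar> = R + 1\<close>, so otherwise the solution would stay bounded and could
  be continued. It never vanishes, since by uniqueness it would then agree with the solution
  through the origin, which exists on \<open>[0, T]\<close>.
\<close>

section \<open>Absolutely continuous functions\<close>

text \<open>Subintervals tagged in the exceptional null set are kept inside an open set of small measure,
  so absolute continuity bounds their total increment.\<close>

lemma has_integral_absolutely_continuous_on:
  fixes f :: "real \<Rightarrow> 'a::banach"
  assumes "a \<le> b"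
    and ac: "absolutely_continuous_on {a..b} f"
    and ae: "AE t in lebesgue. t \<in> {a..b} \<longrightarrow> (f has_vector_derivative f' t) (at t within {a..b})"
  shows "(f' has_integral (f b - f a)) {a..b}"
proof (cases "a = b")
  case True
  then show ?thesis by auto
next
  case False
  then have ab: "a < b" using assms by simp
  obtain N where N: "negligible N"
    and der: "\<And>t. t \<in> {a..b} \<Longrightarrow> t \<notin> N \<Longrightarrow> (f has_vector_derivative f' t) (at t within {a..b})"
    using ae unfolding eventually_ae_filter_negligible by blast
  \<comment> \<open>Setting the integrand to zero on \<open>N\<close> leaves only the increment of
    \<open>f\<close> as the error of a tag in \<open>N\<close>.\<close>
  define g where "g t = (if t \<in> N then 0 else f' t)" for t
  have "(g has_integral (f b - f a)) {a..b}"
    unfolding has_integral_factor_content_real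
  proof (intro allI impI)
    fix e :: real
    assume e: "e > 0"
    \<comment> \<open>One half of the tolerance pays for the tags off \<open>N\<close>, through
      differentiability; the other half pays for the total increment over the tags in
      \<open>N\<close>, through absolute continuity.\<close>
    define e2 where "e2 = e / 2"
    have e2: "e2 > 0" using e by (simp add: e2_def)
    have "\<forall>x. \<exists>d>0. x \<in> {a..b} \<longrightarrow> x \<notin> N \<longrightarrow>
         (\<forall>y\<in>{a..b}. norm (y-x) < d \<longrightarrow> norm (f y - f x - (y-x) *\<^sub>R f' x) \<le> e2 * norm (y-x))"
      using der[unfolded has_vector_derivative_def has_derivative_within_alt] e2 by (metis zero_less_one)
    then obtain d1 where d1: "\<And>x. 0 < d1 x"
       "\<And>x y. \<lbrakk>x \<in> {a..b}; x \<notin> N; y \<in> {a..b}; norm (y-x) < d1 x\<rbrakk>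
          \<Longrightarrow> norm (f y - f x - (y-x) *\<^sub>R f' x) \<le> e2 * norm (y-x)"
      by metis
    have eps: "e2 * (b - a) > 0" using e2 ab by simp
    obtain \<delta> where \<delta>: "\<delta> > 0"
      "\<And>D U. D division_of U \<Longrightarrow> U \<subseteq> {a..b} \<Longrightarrow> (\<Sum>k\<in>D. Sup k - Inf k) < \<delta> \<Longrightarrow>
          (\<Sum>k\<in>D. norm (f (Sup k) - f (Inf k))) < e2 * (b - a)"
      using ac eps unfolding absolutely_continuous_on_def by meson
    obtain V where V: "open V" "N \<subseteq> V" "V - N \<in> lmeasurable" "emeasure lebesgue (V - N) < ennreal \<delta>"
      using sets_lebesgue_outer_open[of N \<delta>] N \<delta>(1) negligible_imp_sets by blast
    have VN: "V \<in> lmeasurable" "measure lebesgue V < \<delta>"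
    proof -
      have "V = (V - N) \<union> N" using V by blast
      moreover have "(V - N) \<union> N \<in> lmeasurable"
        by (intro fmeasurable.Un V negligible_imp_measurable N)
      ultimately show "V \<in> lmeasurable" by simp
      have "measure lebesgue V = measure lebesgue (V - N)"
        using N by (metis \<open>V = (V - N) \<union> N\<close> measure_Un_null_set V(3) fmeasurableD negligible_iff_null_sets)
      also have "\<dots> < \<delta>"
        using V(3,4) \<delta>(1) by (simp add: emeasure_eq_measure2 ennreal_less_iff)
      finally show "measure lebesgue V < \<delta>" .
    qed
    have "\<forall>x. \<exists>d>0. x \<in> N \<longrightarrow> ball x d \<subseteq> V"
      using V by (metis open_contains_ball subsetD zero_less_one)
    then obtain d2 where d2: "\<And>x. 0 < d2 x" "\<And>x. x \<in> N \<Longrightarrow> ball x (d2 x) \<subseteq> V" by metis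
    define d where "d x = min (d1 x) (d2 x)" for x
    have dpos: "d x > 0" for x using d1 d2 by (simp add: d_def)
    have main: "norm ((\<Sum>(x, k)\<in>p. measure lborel k *\<^sub>R g x) - (f b - f a)) \<le> e * measure lborel {a..b}"
      if ptag: "p tagged_division_of {a..b}" and fine: "(\<lambda>x. ball x (d x)) fine p" for p
    proof -
      have finp: "finite p" using ptag by blast
      have ba: "b - a = (\<Sum>(x,K)\<in>p. Sup K - Inf K)" "f b - f a = (\<Sum>(x,K)\<in>p. f(Sup K) - f(Inf K))"
        using additive_tagged_division_1[where f= "\<lambda>x. x"] additive_tagged_division_1[where f= f]
          \<open>a \<le> b\<close> ptag by auto
      define s where "s = {(x,k)\<in>p. x \<in> N}"
      have sp: "s \<subseteq> p" by (auto simp: s_def)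
      have spart: "s tagged_partial_division_of {a..b}"
        using ptag sp tagged_partial_division_subset unfolding tagged_division_of_def by blast
      have sdiv: "(snd ` s) division_of \<Union>(snd ` s)"
        by (rule partial_division_of_tagged_division[OF spart])
      have stag: "s tagged_division_of \<Union>(snd ` s)"
        by (rule tagged_partial_division_of_Union_self[OF spart])
      have sub: "\<Union>(snd ` s) \<subseteq> {a..b}" using ptag sp by fastforce
      have subV: "\<Union>(snd ` s) \<subseteq> V"
      proof
        fix y assume "y \<in> \<Union>(snd ` s)"
        then obtain x k where xk: "(x, k) \<in> p" "x \<in> N" "y \<in> k" by (auto simp: s_def)
        then have "y \<in> ball x (d2 x)" using fine unfolding fine_def d_def by fastforce
        then show "y \<in> V" using d2(2)[OF xk(2)] by blast
      qed
      have "(\<Sum>k\<in>snd ` s. Sup k - Inf k) = sum (measure lebesgue) (snd ` s)"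
      proof (rule sum.cong[OF refl])
        fix k assume "k \<in> snd ` s"
        then obtain u v where "k = {u..v}" "k \<noteq> {}"
          using division_ofD(3,4)[OF sdiv] by (metis box_real(2))
        then show "Sup k - Inf k = measure lebesgue k" by auto
      qed
      also have "\<dots> = measure lebesgue (\<Union>(snd ` s))"
        using content_division[OF sdiv] by simp
      also have "\<dots> \<le> measure lebesgue V"
        by (rule measure_mono_fmeasurable[OF subV _ VN(1)]) (use lmeasurable_division[OF sdiv] in blast)
      also have "\<dots> < \<delta>" by (rule VN)
      finally have "(\<Sum>k\<in>snd ` s. Sup k - Inf k) < \<delta>" .
      from \<delta>(2)[OF sdiv sub this]
      have "(\<Sum>k\<in>snd ` s. norm (f (Sup k) - f (Inf k))) < e2 * (b - a)" .
      moreover have "(\<Sum>(x,k)\<in>s. norm (f (Sup k) - f (Inf k))) = (\<Sum>k\<in>snd ` s. norm (f (Sup k) - f (Inf k)))"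
      proof -
        \<comment> \<open>Two tags may share an interval only if that interval is degenerate, and
          then its increment vanishes, so passing from tagged intervals to intervals loses nothing.
          The value at the empty set is fixed because \<open>Sup\<close> and \<open>Inf\<close> are
          unspecified there, while the summation lemma also asks about empty boxes.\<close>
        define \<phi> where "\<phi> k = (if k = {} then 0 else norm (f (Sup k) - f (Inf k)))" for k
        have ne: "k \<noteq> {}" if "k \<in> snd ` s" for k
          using division_ofD(3)[OF sdiv that] .
        have "(\<Sum>(x,k)\<in>s. \<phi> k) = (\<Sum>k\<in>snd ` s. \<phi> k)"
          by (rule sum.over_tagged_division_lemma[OF stag]) (auto simp: \<phi>_def box_eq_empty)
        moreover have "(\<Sum>(x,k)\<in>s. \<phi> k) = (\<Sum>(x,k)\<in>s. norm (f (Sup k) - f (Inf k)))"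
          by (intro sum.cong refl) (use ne in \<open>force simp: \<phi>_def\<close>)
        moreover have "(\<Sum>k\<in>snd ` s. \<phi> k) = (\<Sum>k\<in>snd ` s. norm (f (Sup k) - f (Inf k)))"
          by (intro sum.cong refl) (use ne in \<open>force simp: \<phi>_def\<close>)
        ultimately show ?thesis by simp
      qed
      ultimately have sN: "(\<Sum>(x,k)\<in>s. norm (f (Sup k) - f (Inf k))) < e2 * (b - a)" by simp
      have "norm (\<Sum>(x, K) \<in> p. (measure lborel K *\<^sub>R g x) - (f (Sup K) - f (Inf K)))
          \<le> (\<Sum>q\<in>p. e2 * (case q of (x, k) \<Rightarrow> Sup k - Inf k) +
               (if q \<in> s then (case q of (x, k) \<Rightarrow> norm (f (Sup k) - f (Inf k))) else 0))"
      proof (rule sum_norm_le)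
        fix q assume "q \<in> p"
        then obtain x K where q: "q = (x, K)" and xK: "(x, K) \<in> p" by (cases q) auto
        then have "x \<in> K" and kab: "K \<subseteq> {a..b}"
          using ptag by blast+
        then obtain u v where k: "K = {u..v}"
          using ptag xK by (metis box_real(2) tagged_division_ofD(4))
        have uv: "u \<le> v" using \<open>x \<in> K\<close> unfolding k by auto
        have xab: "x \<in> {a..b}" using \<open>x \<in> K\<close> kab by blast
        have uK: "u \<in> K" "v \<in> K" using uv by (simp_all add: k)
        have SI: "Sup K = v" "Inf K = u" "measure lborel K = v - u" using uv by (simp_all add: k)
        have uvb: "norm (u - x) < d1 x" "norm (v - x) < d1 x"
          using fine xK uK unfolding fine_def d_def by (fastforce simp: dist_real_def)+
        have "norm (measure lborel K *\<^sub>R g x - (f (Sup K) - f (Inf K))) \<le>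
           e2 * (Sup K - Inf K) + (if (x, K) \<in> s then norm (f (Sup K) - f (Inf K)) else 0)"
        proof (cases "x \<in> N")
          case True
          then have "(x, K) \<in> s" using xK by (simp add: s_def)
          then show ?thesis using True e2 uv by (simp add: g_def SI norm_minus_commute)
        next
          case False
          then have ns: "(x, K) \<notin> s" by (simp add: s_def)
          \<comment> \<open>Straddle estimate: the increment is split at the tag, and since
            \<open>x\<close> lies between \<open>u\<close> and \<open>v\<close> the two errors add
            up to a multiple of \<open>v - u\<close>.\<close>
          have "norm ((v - u) *\<^sub>R f' x - (f v - f u)) = norm (f u - f x - (u - x) *\<^sub>R f' x - (f v - f x - (v - x) *\<^sub>R f' x))"
            by (auto simp: algebra_simps)
          also have "\<dots> \<le> norm (f u - f x - (u - x) *\<^sub>R f' x) + norm (f v - f x - (v - x) *\<^sub>R f' x)"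
            by (rule norm_triangle_ineq4)
          also have "\<dots> \<le> e2 * norm (u - x) + e2 * norm (v - x)"
            using d1(2)[OF xab False _ uvb(1)] d1(2)[OF xab False _ uvb(2)] uK kab by (intro add_mono) auto
          also have "\<dots> = e2 * (v - u)"
            using \<open>x \<in> K\<close> by (auto simp: k field_simps)
          finally show ?thesis using False ns by (simp add: g_def SI)
        qed
        then show "norm (case q of (x, K) \<Rightarrow> measure lborel K *\<^sub>R g x - (f (Sup K) - f (Inf K))) \<le>
            e2 * (case q of (x, k) \<Rightarrow> Sup k - Inf k) +
            (if q \<in> s then (case q of (x, k) \<Rightarrow> norm (f (Sup k) - f (Inf k))) else 0)"
          by (simp only: q prod.case)
      qed
      also have "\<dots> = e2 * (\<Sum>(x,k)\<in>p. Sup k - Inf k) + (\<Sum>(x,k)\<in>s. norm (f (Sup k) - f (Inf k)))"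
        using sp finp
        by (simp add: sum.distrib sum_distrib_left sum.inter_restrict[symmetric] Int_absorb1)
      also have "\<dots> \<le> e * (b - a)"
        using sN ba(1) by (simp add: e2_def)
      finally show ?thesis
        using \<open>a \<le> b\<close> by (simp add: ba(2) split_def sum_subtractf)
    qed
    show "\<exists>d. gauge d \<and> (\<forall>p. p tagged_division_of {a..b} \<and> d fine p \<longrightarrow>
        norm ((\<Sum>(x, k)\<in>p. measure lborel k *\<^sub>R g x) - (f b - f a)) \<le> e * measure lborel {a..b})"
      using main gauge_ball_dependent[of d] dpos by blast
  qed
  then show ?thesis
    by (rule has_integral_spike[OF N, rotated]) (auto simp: g_def)
qed

text \<open>Increments of \<open>g\<close> are dominated by those of \<open>f\<close>, so the
  modulus of \<open>f\<close> at a rescaled tolerance serves for \<open>g\<close>. It is applied to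
  half the squared norm of a solution. The factor \<open>\<bar>L\<bar> + 1\<close> keeps the
  rescaling positive for every real \<open>L\<close>.\<close>

lemma absolutely_continuous_on_Lipschitz:
  assumes f: "absolutely_continuous_on {a..b} f"
    and L: "\<And>s t. s \<in> {a..b} \<Longrightarrow> t \<in> {a..b} \<Longrightarrow> norm (g t - g s) \<le> L * norm (f t - f s)"
  shows "absolutely_continuous_on {a..b} g"
  unfolding absolutely_continuous_on_def
proof (intro allI impI)
  fix \<epsilon> :: real
  assume "\<epsilon> > 0"
  then have "\<epsilon> / (\<bar>L\<bar> + 1) > 0" by (simp add: add_nonneg_pos)
  then obtain \<delta> where \<delta>: "\<delta> > 0"
    "\<And>D U. D division_of U \<and> U \<subseteq> {a..b} \<and> (\<Sum>k\<in>D. Sup k - Inf k) < \<delta> \<Longrightarrow>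
        (\<Sum>k\<in>D. norm (f (Sup k) - f (Inf k))) < \<epsilon> / (\<bar>L\<bar> + 1)"
    using f unfolding absolutely_continuous_on_def by meson
  have "(\<Sum>k\<in>D. norm (g (Sup k) - g (Inf k))) < \<epsilon>"
    if D: "D division_of U \<and> U \<subseteq> {a..b} \<and> (\<Sum>k\<in>D. Sup k - Inf k) < \<delta>" for D U
  proof -
    have "(\<Sum>k\<in>D. norm (g (Sup k) - g (Inf k))) \<le> (\<Sum>k\<in>D. (\<bar>L\<bar> + 1) * norm (f (Sup k) - f (Inf k)))"
    proof (rule sum_mono)
      fix k assume k: "k \<in> D"
      then obtain u v where uv: "k = {u..v}" "k \<noteq> {}" "k \<subseteq> U"
        using D by (metis box_real(2) division_ofD(2,3,4))
      have "{u..v} \<subseteq> {a..b}" using uv D by blast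
      with uv have "a \<le> u" "u \<le> v" "v \<le> b" by auto
      then have "norm (g v - g u) \<le> L * norm (f v - f u)"
        by (intro L) auto
      also have "\<dots> \<le> (\<bar>L\<bar> + 1) * norm (f v - f u)"
        by (intro mult_right_mono) auto
      finally show "norm (g (Sup k) - g (Inf k)) \<le> (\<bar>L\<bar> + 1) * norm (f (Sup k) - f (Inf k))"
        using uv by simp
    qed
    also have "\<dots> = (\<bar>L\<bar> + 1) * (\<Sum>k\<in>D. norm (f (Sup k) - f (Inf k)))"
      by (simp add: sum_distrib_left)
    also have "\<dots> < (\<bar>L\<bar> + 1) * (\<epsilon> / (\<bar>L\<bar> + 1))"
      by (intro mult_strict_left_mono \<delta>(2)[OF D]) auto
    finally show ?thesis by simp
  qed
  then show "\<exists>\<delta>>0. \<forall>D U. D division_of U \<and> U \<subseteq> {a..b} \<and> (\<Sum>k\<in>D. Sup k - Inf k) < \<delta> \<longrightarrow>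
        (\<Sum>k\<in>D. norm (g (Sup k) - g (Inf k))) < \<epsilon>"
    using \<delta>(1) by blast
qed

text \<open>The norm of \<open>f\<close> is truncated at a high level \<open>n\<close>: the bounded
  part contributes at most \<open>n\<close> times the total length, and the remainder
  \<open>h\<close> has a small integral over all of \<open>{a..b}\<close>, however the subintervals
  are chosen.\<close>

lemma absolutely_continuous_on_indefinite_integral:
  fixes f :: "real \<Rightarrow> 'a::euclidean_space"
  assumes f: "f absolutely_integrable_on {a..b}"
  shows "absolutely_continuous_on {a..b} (\<lambda>t. c + integral {a..t} f)"
  unfolding absolutely_continuous_on_def
proof (intro allI impI)
  fix \<epsilon> :: real
  assume \<epsilon>: "\<epsilon> > 0"
  define g where "g n t = min (norm (f t)) (real n)" for n t
  have nf: "(\<lambda>t. norm (f t)) absolutely_integrable_on {a..b}"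
    using f by (rule absolutely_integrable_norm[unfolded o_def])
  have g: "g n absolutely_integrable_on {a..b}" for n
    unfolding g_def by (intro absolutely_integrable_min_1 nf absolutely_integrable_on_const) auto
  have "(\<lambda>n. integral {a..b} (g n)) \<longlonglongrightarrow> integral {a..b} (\<lambda>t. norm (f t))"
  proof (rule dominated_convergence(2))
    show "g n integrable_on {a..b}" for n
      using g by (rule set_lebesgue_integral_eq_integral(1))
    show "(\<lambda>t. norm (f t)) integrable_on {a..b}"
      using nf by (rule set_lebesgue_integral_eq_integral(1))
    show "norm (g n t) \<le> norm (f t)" for n t by (simp add: g_def)
    show "(\<lambda>n. g n t) \<longlonglongrightarrow> norm (f t)" for t
    proof (rule tendsto_eventually)
      obtain m where "norm (f t) \<le> real m" using real_arch_simple by blast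
      then have "g n t = norm (f t)" if "n \<ge> m" for n
        using that by (simp add: g_def)
      then show "\<forall>\<^sub>F n in sequentially. g n t = norm (f t)"
        unfolding eventually_sequentially by blast
    qed
  qed
  then have "\<forall>\<^sub>F n in sequentially. dist (integral {a..b} (g n)) (integral {a..b} (\<lambda>t. norm (f t))) < \<epsilon> / 2"
    by (rule tendstoD) (use \<epsilon> in auto)
  then obtain n where n: "dist (integral {a..b} (g n)) (integral {a..b} (\<lambda>t. norm (f t))) < \<epsilon> / 2"
    using eventually_happens'[OF sequentially_bot] by blast
  define h where "h t = norm (f t) - g n t" for t
  have h: "h absolutely_integrable_on {a..b}"
    unfolding h_def by (intro set_integral_diff(1) nf g)
  have hpos: "h t \<ge> 0" for t by (simp add: h_def g_def)
  have hle: "norm (f t) \<le> real n + h t" for t by (simp add: h_def g_def)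
  have hsmall: "integral {a..b} h < \<epsilon> / 2"
    using n unfolding h_def
    by (subst integral_diff)
       (auto simp: dist_real_def abs_if split: if_splits intro!: set_lebesgue_integral_eq_integral(1) nf g)
  \<comment> \<open>Makes \<open>n\<close> times the total length at most half of the tolerance; the
    added one avoids division by zero when \<open>n = 0\<close>.\<close>
  define \<delta> where "\<delta> = \<epsilon> / (2 * (real n + 1))"
  have \<delta>: "\<delta> > 0" using \<epsilon> by (simp add: \<delta>_def)
  have "(\<Sum>k\<in>D. norm (c + integral {a..Sup k} f - (c + integral {a..Inf k} f))) < \<epsilon>"
    if D: "D division_of U" "U \<subseteq> {a..b}" and len: "(\<Sum>k\<in>D. Sup k - Inf k) < \<delta>" for D U
  proof -
    have "(\<Sum>k\<in>D. norm (c + integral {a..Sup k} f - (c + integral {a..Inf k} f)))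
        \<le> (\<Sum>k\<in>D. real n * (Sup k - Inf k) + integral k h)"
    proof (rule sum_mono)
      fix k assume k: "k \<in> D"
      then obtain u v where uv: "k = {u..v}" "k \<noteq> {}" "k \<subseteq> U"
        using D by (metis box_real(2) division_ofD(2,3,4))
      have sub: "{u..v} \<subseteq> {a..b}" using uv D(2) by blast
      with uv have le: "u \<le> v" "a \<le> u" "v \<le> b" by auto
      have fi: "f absolutely_integrable_on {u..v}" "(\<lambda>t. norm (f t)) absolutely_integrable_on {u..v}"
        "h absolutely_integrable_on {u..v}"
        using absolutely_integrable_on_subinterval[OF _ sub] f nf h by auto
      note ii = fi[THEN set_lebesgue_integral_eq_integral(1)]
      have "f integrable_on {a..v}"
        using f le set_lebesgue_integral_eq_integral(1) absolutely_integrable_on_subinterval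
        by (metis atLeastatMost_subset_iff order_refl)
      then have "integral {a..v} f - integral {a..u} f = integral {u..v} f"
        using Henstock_Kurzweil_Integration.integral_combine[of a u v f] le by (simp add: algebra_simps)
      then have "norm (c + integral {a..v} f - (c + integral {a..u} f)) = norm (integral {u..v} f)" by simp
      also have "\<dots> \<le> integral {u..v} (\<lambda>t. real n + h t)"
        by (rule Henstock_Kurzweil_Integration.integral_norm_bound_integral)
           (use ii hle in \<open>auto intro!: integrable_add integrable_const_ivl\<close>)
      also have "\<dots> = real n * (v - u) + integral {u..v} h"
        using ii le by (subst integral_add) (auto simp: integrable_const_ivl)
      finally show "norm (c + integral {a..Sup k} f - (c + integral {a..Inf k} f)) \<le> real n * (Sup k - Inf k) + integral k h"
        using uv le by simp
    qed
    also have "\<dots> = real n * (\<Sum>k\<in>D. Sup k - Inf k) + (\<Sum>k\<in>D. integral k h)"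
      by (simp add: sum.distrib sum_distrib_left)
    \<comment> \<open>The intervals do not overlap and \<open>h\<close> is nonnegative, so one bound
      covers all of them together.\<close>
    also have "(\<Sum>k\<in>D. integral k h) \<le> integral {a..b} h"
    proof -
      have hU: "h integrable_on U"
        by (rule integrable_on_subdivision[OF D(1) _ D(2)])
           (use h set_lebesgue_integral_eq_integral(1) in blast)
      have "(\<Sum>k\<in>D. integral k h) = integral U h"
        by (rule integral_combine_division_topdown[OF hU D(1), symmetric])
      also have "\<dots> \<le> integral {a..b} h"
        by (rule integral_subset_le) (use D hU hpos h set_lebesgue_integral_eq_integral(1) in auto)
      finally show ?thesis .
    qed
    also have "real n * (\<Sum>k\<in>D. Sup k - Inf k) + integral {a..b} h < \<epsilon> / 2 + \<epsilon> / 2"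
    proof (rule add_le_less_mono)
      have "real n * (\<Sum>k\<in>D. Sup k - Inf k) \<le> real n * \<delta>"
        using len by (intro mult_left_mono) auto
      also have "\<dots> \<le> (real n + 1) * \<delta>" using \<delta> by (simp add: algebra_simps)
      also have "\<dots> = \<epsilon> / 2" by (simp add: \<delta>_def field_simps)
      finally show "real n * (\<Sum>k\<in>D. Sup k - Inf k) \<le> \<epsilon> / 2" .
    qed (rule hsmall)
    finally show ?thesis by simp
  qed
  then show "\<exists>\<delta>>0. \<forall>D U. D division_of U \<and> U \<subseteq> {a..b} \<and> (\<Sum>k\<in>D. Sup k - Inf k) < \<delta> \<longrightarrow>
      (\<Sum>k\<in>D. norm (c + integral {a..Sup k} f - (c + integral {a..Inf k} f))) < \<epsilon>"
    using \<delta> by blast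
qed

section \<open>Caratheodory solutions\<close>

text \<open>Passes from the equation almost everywhere to the integral equation, the form from which
  continuity, integrability and bounds on increments are derived.\<close>

lemma caratheodory_solution_has_integral:
  assumes "caratheodory_solution F I z" "{s..t} \<subseteq> I" "s \<le> t"
  shows "((\<lambda>\<tau>. F \<tau> (z \<tau>)) has_integral (z t - z s)) {s..t}"
proof (rule has_integral_absolutely_continuous_on[OF assms(3)])
  show "absolutely_continuous_on {s..t} z"
    using assms unfolding caratheodory_solution_def by blast
  have "AE \<tau> in lebesgue. \<tau> \<in> I \<longrightarrow> (z has_vector_derivative F \<tau> (z \<tau>)) (at \<tau> within I)"
    using assms unfolding caratheodory_solution_def by blast
  then show "AE \<tau> in lebesgue. \<tau> \<in> {s..t} \<longrightarrow> (z has_vector_derivative F \<tau> (z \<tau>)) (at \<tau> within {s..t})"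
    by (rule AE_mp) (use assms(2) in \<open>blast intro: AE_I2 has_vector_derivative_within_subset\<close>)
qed

lemma caratheodory_solution_continuous_on:
  assumes "caratheodory_solution F I z" "{a..b} \<subseteq> I"
  shows "continuous_on {a..b} z"
proof (cases "a \<le> b")
  case True
  let ?f = "\<lambda>\<tau>. F \<tau> (z \<tau>)"
  have int: "?f integrable_on {a..b}"
    using caratheodory_solution_has_integral[OF assms True] by blast
  have "z t = z a + integral {a..t} ?f" if "t \<in> {a..b}" for t
  proof -
    have "{a..t} \<subseteq> I" using that assms(2) by auto
    then show ?thesis
      using caratheodory_solution_has_integral[OF assms(1), of a t] that
      by (simp add: integral_unique)
  qed
  note eq = this
  have "continuous_on {a..b} (\<lambda>t. z a + integral {a..t} ?f)"
    by (intro continuous_intros indefinite_integral_continuous_1 int)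
  then show ?thesis by (rule continuous_on_eq) (rule eq[symmetric])
qed simp

lemma caratheodory_solution_subset:
  assumes "caratheodory_solution F I z" "I' \<subseteq> I" "is_interval I'"
  shows "caratheodory_solution F I' z"
proof -
  have "AE t in lebesgue. t \<in> I \<longrightarrow> (z has_vector_derivative F t (z t)) (at t within I)"
    using assms unfolding caratheodory_solution_def by blast
  then have "AE t in lebesgue. t \<in> I' \<longrightarrow> (z has_vector_derivative F t (z t)) (at t within I')"
    by (rule AE_mp) (use assms(2) in \<open>blast intro: AE_I2 has_vector_derivative_within_subset\<close>)
  then show ?thesis
    using assms unfolding caratheodory_solution_def by blast
qed

lemma caratheodory_dominating_function:
  assumes "caratheodory F" "compact K"
  obtains m N where "m integrable_on {a..b}" "negligible N"
    "\<And>t x. t \<in> {a..b} \<Longrightarrow> t \<notin> N \<Longrightarrow> x \<in> K \<Longrightarrow> norm (F t x) \<le> m t"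
proof -
  obtain m where m: "set_integrable lebesgue {a..b} m"
    and "AE t in lebesgue. t \<in> {a..b} \<longrightarrow> (\<forall>z\<in>K. norm (F t z) \<le> m t)"
    using assms unfolding caratheodory_def by blast
  then obtain N where "negligible N"
    "\<And>t x. t \<in> {a..b} \<Longrightarrow> t \<notin> N \<Longrightarrow> x \<in> K \<Longrightarrow> norm (F t x) \<le> m t"
    unfolding eventually_ae_filter_negligible by blast
  moreover have "(\<lambda>t. \<bar>m t\<bar>) integrable_on {a..b}"
    using set_lebesgue_integral_eq_integral(1)[OF set_integrable_abs[OF m]] .
  ultimately show ?thesis
    by (intro that[of "\<lambda>t. \<bar>m t\<bar>" N]) (auto intro: order_trans[OF _ abs_ge_self])
qed

text \<open>Domination holds only off \<open>N\<close>; removing \<open>N\<close> from the domain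
  makes it hold everywhere, and a negligible change of domain then restores
  \<open>S\<close>.\<close>

lemma AE_bounded_imp_absolutely_integrable:
  fixes f :: "'a::euclidean_space \<Rightarrow> 'b::euclidean_space"
  assumes f: "f \<in> borel_measurable (lebesgue_on S)" and S: "S \<in> sets lebesgue"
    and m: "m integrable_on S" and N: "negligible N"
    and le: "\<And>x. x \<in> S \<Longrightarrow> x \<notin> N \<Longrightarrow> norm (f x) \<le> m x"
  shows "f absolutely_integrable_on S"
proof -
  have "f absolutely_integrable_on (S - N)"
  proof (rule measurable_bounded_by_integrable_imp_absolutely_integrable[where g = m])
    show "f \<in> borel_measurable (lebesgue_on (S - N))"
      using measurable_restrict_mono[OF f] by blast
    show "S - N \<in> sets lebesgue" using S N negligible_imp_sets by blast
    show "m integrable_on S - N"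
      by (rule integrable_spike_set[OF m]) (use N in \<open>auto intro: negligible_subset\<close>)
  qed (use le in auto)
  then show ?thesis
    by (rule absolutely_integrable_spike_set) (use N in \<open>auto intro: negligible_subset\<close>)
qed

text \<open>Measurability of the superposition comes from the integral equation, since a gauge
  integrable function is measurable. The trajectory over a compact interval is compact, so a
  dominating function is available.\<close>

lemma caratheodory_solution_absolutely_integrable:
  assumes F: "caratheodory F" and z: "caratheodory_solution F I z" "{s..t} \<subseteq> I"
  shows "(\<lambda>\<tau>. F \<tau> (z \<tau>)) absolutely_integrable_on {s..t}"
proof (cases "s \<le> t")
  case True
  have "compact (z ` {s..t})"
    by (intro compact_continuous_image caratheodory_solution_continuous_on[OF z]) auto
  from caratheodory_dominating_function[OF F this, of s t] obtain m N where
    m: "m integrable_on {s..t}" "negligible N"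
    "\<And>\<tau> x. \<tau> \<in> {s..t} \<Longrightarrow> \<tau> \<notin> N \<Longrightarrow> x \<in> z ` {s..t} \<Longrightarrow> norm (F \<tau> x) \<le> m \<tau>" by metis
  have "(\<lambda>\<tau>. F \<tau> (z \<tau>)) integrable_on {s..t}"
    using caratheodory_solution_has_integral[OF z True] by blast
  then have "(\<lambda>\<tau>. F \<tau> (z \<tau>)) \<in> borel_measurable (lebesgue_on {s..t})"
    by (rule integrable_imp_measurable)
  then show ?thesis
    by (rule AE_bounded_imp_absolutely_integrable[OF _ _ m(1,2)]) (use m(3) in auto)
qed (simp add: set_integrable_def)

lemma caratheodory_solution_increment_le:
  assumes z: "caratheodory_solution F I z" "{s..t} \<subseteq> I" "s \<le> t"
    and m: "m integrable_on {s..t}" "negligible N"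
      "\<And>\<tau>. \<tau> \<in> {s..t} \<Longrightarrow> \<tau> \<notin> N \<Longrightarrow> norm (F \<tau> (z \<tau>)) \<le> m \<tau>"
  shows "norm (z t - z s) \<le> integral {s..t} m"
proof -
  have hi: "((\<lambda>\<tau>. F \<tau> (z \<tau>)) has_integral (z t - z s)) {s..t}"
    by (rule caratheodory_solution_has_integral[OF z])
  \<comment> \<open>Both integrands are set to zero on \<open>N\<close>, so that the bound holds at
    every point and not just almost everywhere.\<close>
  have 1: "((\<lambda>\<tau>. if \<tau> \<in> N then 0 else F \<tau> (z \<tau>)) has_integral (z t - z s)) {s..t}"
    by (rule has_integral_spike[OF m(2) _ hi]) auto
  have 2: "(\<lambda>\<tau>. if \<tau> \<in> N then 0 else m \<tau>) integrable_on {s..t}"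
    by (rule integrable_spike[OF m(1,2)]) auto
  have "norm (integral {s..t} (\<lambda>\<tau>. if \<tau> \<in> N then 0 else F \<tau> (z \<tau>))) \<le> integral {s..t} (\<lambda>\<tau>. if \<tau> \<in> N then 0 else m \<tau>)"
    by (rule Henstock_Kurzweil_Integration.integral_norm_bound_integral) (use 1 2 m(3) in auto)
  also have "integral {s..t} (\<lambda>\<tau>. if \<tau> \<in> N then 0 else m \<tau>) = integral {s..t} m"
    by (rule integral_spike[OF m(2)]) auto
  finally show ?thesis using 1 by (simp add: integral_unique)
qed

text \<open>A bounded solution extends to the end point by its own integral formula; no existence
  theorem is needed.\<close>

lemma caratheodory_solution_extends:
  assumes F: "caratheodory F" and z: "caratheodory_solution F {a..<b} z" and "a < b"
    and K: "compact K" "z ` {a..<b} \<subseteq> K"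
  obtains w where "caratheodory_solution F {a..b} w" "\<And>t. t \<in> {a..<b} \<Longrightarrow> w t = z t"
proof -
  let ?f = "\<lambda>\<tau>. F \<tau> (z \<tau>)"
  obtain m N where m: "m integrable_on {a..b}" "negligible N"
    "\<And>t x. t \<in> {a..b} \<Longrightarrow> t \<notin> N \<Longrightarrow> x \<in> K \<Longrightarrow> norm (F t x) \<le> m t"
    using caratheodory_dominating_function[OF F K(1), of a b] by metis
  have int: "?f integrable_on {a..t}" if "t < b" for t
  proof (cases "a \<le> t")
    case True
    moreover have "{a..t} \<subseteq> {a..<b}" using that by auto
    ultimately show ?thesis
      using caratheodory_solution_has_integral[OF z] by blast
  qed auto
  \<comment> \<open>The integral equation is available only on compact subintervals, so the
    half-open interval is exhausted by countably many of them and measurability is glued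
    together.\<close>
  have "?f \<in> borel_measurable (lebesgue_on {a..<b})"
  proof (rule measurable_piecewise_restrict[where C = "range (\<lambda>n. {a..b - 1 / (real n + 1)})"])
    show "space (lebesgue_on {a..<b}) \<subseteq> \<Union> (range (\<lambda>n. {a..b - 1 / (real n + 1)}))"
    proof
      fix t assume "t \<in> space (lebesgue_on {a..<b})"
      then have t: "a \<le> t" "0 < b - t" by auto
      then obtain n where "1 / (real n + 1) < b - t"
        by (metis add.commute nat_approx_posE of_nat_Suc)
      then show "t \<in> \<Union> (range (\<lambda>n. {a..b - 1 / (real n + 1)}))"
        using t by (auto intro!: exI[of _ n])
    qed
    show "?f \<in> borel_measurable (restrict_space (lebesgue_on {a..<b}) \<Omega>)"
      if "\<Omega> \<in> range (\<lambda>n. {a..b - 1 / (real n + 1)})" for \<Omega>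
    proof -
      from that obtain n where \<Omega>: "\<Omega> = {a..b - 1 / (real n + 1)}" by blast
      have lt: "b - 1 / (real n + 1) < b" by simp
      then have "{a..<b} \<inter> \<Omega> = \<Omega>"
        unfolding \<Omega> by (auto intro: le_less_trans[OF _ lt])
      then have "restrict_space (lebesgue_on {a..<b}) \<Omega> = lebesgue_on \<Omega>"
        by (subst restrict_restrict_space) (auto simp: \<Omega>)
      then show ?thesis
        using integrable_imp_measurable[OF int[OF lt]] \<Omega> by simp
    qed
    show "\<Omega> \<inter> space (lebesgue_on {a..<b}) \<in> sets (lebesgue_on {a..<b})"
      if "\<Omega> \<in> range (\<lambda>n. {a..b - 1 / (real n + 1)})" for \<Omega>
      using that by (force simp: sets_restrict_space_iff)
  qed simp
  then have "?f absolutely_integrable_on {a..<b}"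
  proof (rule AE_bounded_imp_absolutely_integrable[OF _ _ _ m(2)])
    show "m integrable_on {a..<b}"
      by (rule integrable_spike_set[OF m(1)]) (auto intro: negligible_subset[of "{b}"])
    show "norm (?f t) \<le> m t" if "t \<in> {a..<b}" "t \<notin> N" for t
      using that K(2) by (intro m(3)) auto
  qed simp
  then have f: "?f absolutely_integrable_on {a..b}"
    by (rule absolutely_integrable_spike_set) (auto intro: negligible_subset[of "{b}"])
  define w where "w t = z a + integral {a..t} ?f" for t
  have wz: "w t = z t" if "t \<in> {a..<b}" for t
  proof -
    have "{a..t} \<subseteq> {a..<b}" "a \<le> t" using that by auto
    then show ?thesis
      using caratheodory_solution_has_integral[OF z, of a t] by (simp add: w_def integral_unique)
  qed
  have "caratheodory_solution F {a..b} w"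
    unfolding caratheodory_solution_def
  proof (intro conjI allI impI)
    fix c d assume cd: "{c..d} \<subseteq> {a..b}"
    have "absolutely_continuous_on {a..b} w"
      unfolding w_def by (rule absolutely_continuous_on_indefinite_integral[OF f])
    then show "absolutely_continuous_on {c..d} w"
      using cd unfolding absolutely_continuous_on_def by (meson order_trans)
  next
    have 1: "AE t in lebesgue. t \<in> {a..<b} \<longrightarrow> (z has_vector_derivative F t (z t)) (at t within {a..<b})"
      using z unfolding caratheodory_solution_def by blast
    \<comment> \<open>At the new end point nothing is known about the derivative, but a single point
      is negligible; at any earlier time the closed and the half-open interval give the same
      limits.\<close>
    have 2: "AE t in lebesgue. t \<noteq> b"
      unfolding eventually_ae_filter_negligible by (intro exI[of _ "{b}"]) auto
    from 1 2 show "AE t in lebesgue. t \<in> {a..b} \<longrightarrow> (w has_vector_derivative F t (w t)) (at t within {a..b})"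
    proof (eventually_elim, intro impI)
      fix t assume H: "t \<in> {a..<b} \<longrightarrow> (z has_vector_derivative F t (z t)) (at t within {a..<b})"
        "t \<noteq> b" "t \<in> {a..b}"
      then have t: "t \<in> {a..<b}" by auto
      have "(w has_vector_derivative F t (z t)) (at t within {a..<b})"
        by (rule has_vector_derivative_transform[OF t wz]) (use H t in auto)
      moreover have "at t within {a..<b} = at t within {a..b}"
        by (rule at_within_nhd[of t "{..<b}"]) (use t in auto)
      ultimately show "(w has_vector_derivative F t (w t)) (at t within {a..b})"
        using wz[OF t] by simp
    qed
  qed (simp add: is_interval_cc)
  then show ?thesis using wz that by blast
qed

section \<open>Growth of the norm at the blow-up time\<close>

lemma blows_up_at_not_bounded:
  assumes F: "caratheodory F" and B: "blows_up_at F z TF" and "compact K"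
  shows "\<not> z ` {0..<TF} \<subseteq> K"
proof
  assume "z ` {0..<TF} \<subseteq> K"
  then obtain w where w: "caratheodory_solution F {0..TF} w" "\<And>t. t \<in> {0..<TF} \<Longrightarrow> w t = z t"
    using caratheodory_solution_extends[OF F _ _ \<open>compact K\<close>] B unfolding blows_up_at_def by metis
  have "TF > 0" using B unfolding blows_up_at_def by blast
  then have "{0..<TF} \<subset> {0..TF}" "{0..TF} \<subseteq> {0..}" by auto
  then show False
    using B w unfolding blows_up_at_def by metis
qed

lemma blows_up_at_norm_at_top:
  assumes F: "caratheodory F" and B: "blows_up_at F z TF"
  shows "filterlim (\<lambda>t. norm (z t)) at_top (at_left TF)"
  unfolding filterlim_at_top
proof
  fix R0 :: real
  define R where "R = \<bar>R0\<bar>"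
  have TF: "TF > 0" and z: "caratheodory_solution F {0..<TF} z"
    using B unfolding blows_up_at_def by auto
  obtain m N where m: "m integrable_on {0..TF}" "negligible N"
    "\<And>t x. t \<in> {0..TF} \<Longrightarrow> t \<notin> N \<Longrightarrow> x \<in> cball 0 (R + 1) \<Longrightarrow> norm (F t x) \<le> m t"
    using caratheodory_dominating_function[OF F compact_cball, of 0 TF] by metis
  define M where "M t = integral {0..t} m" for t
  have "continuous_on {0..TF} M"
    unfolding M_def by (rule indefinite_integral_continuous_1[OF m(1)])
  \<comment> \<open>Two values of \<open>M\<close> within \<open>1 / 2\<close> of
    \<open>M TF\<close> differ by less than one, which is the width of the shell between the radii
    \<open>R\<close> and \<open>R + 1\<close>.\<close>
  then obtain \<delta> where \<delta>: "\<delta> > 0" "\<And>t. t \<in> {0..TF} \<Longrightarrow> dist t TF < \<delta> \<Longrightarrow> dist (M t) (M TF) < 1 / 2"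
    unfolding continuous_on_iff using TF by (metis atLeastAtMost_iff half_gt_zero less_eq_real_def zero_less_one)
  have "R < norm (z s)" if s: "max 0 (TF - \<delta>) < s" "s < TF" for s
  proof (rule ccontr)
    assume "\<not> R < norm (z s)"
    then have zs: "norm (z s) \<le> R" by simp
    have stay: "norm (z t) \<le> R + 1" if t: "t \<in> {s..<TF}" for t
    proof (rule ccontr)
      assume "\<not> norm (z t) \<le> R + 1"
      then have zt: "norm (z t) > R + 1" by simp
      have sub: "{s..t} \<subseteq> {0..<TF}" using s t by auto
      have cont: "continuous_on {s..t} (\<lambda>\<tau>. norm (z \<tau>))"
        by (intro continuous_on_norm caratheodory_solution_continuous_on[OF z sub])
      \<comment> \<open>The least element \<open>\<tau>\<close> of \<open>S\<close> is the first
        time after \<open>s\<close> on the sphere of radius \<open>R + 1\<close>. Up to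
        \<open>\<tau>\<close> the solution stays in the ball on which \<open>m\<close> dominates the
        field.\<close>
      define S where "S = {\<tau> \<in> {s..t}. norm (z \<tau>) = R + 1}"
      have hit: "\<exists>\<tau>\<in>S. \<tau> \<le> \<sigma>" if "\<sigma> \<in> {s..t}" "norm (z \<sigma>) \<ge> R + 1" for \<sigma>
      proof -
        have "continuous_on {s..\<sigma>} (\<lambda>\<tau>. norm (z \<tau>))"
          by (rule continuous_on_subset[OF cont]) (use that in auto)
        then obtain \<tau> where "s \<le> \<tau>" "\<tau> \<le> \<sigma>" "norm (z \<tau>) = R + 1"
          using IVT'[of "\<lambda>\<tau>. norm (z \<tau>)" s "R + 1" \<sigma>] zs \<open>\<sigma> \<in> {s..t}\<close> \<open>norm (z \<sigma>) \<ge> R + 1\<close> by auto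
        then show ?thesis using that by (auto simp: S_def)
      qed
      have "closed S"
        unfolding S_def by (rule continuous_closed_preimage_constant[OF cont]) simp
      moreover have "bounded S"
        by (rule bounded_subset[of "{s..t}"]) (auto simp: S_def)
      moreover have "S \<noteq> {}" using hit[of t] t zt by auto
      ultimately obtain \<tau> where \<tau>: "\<tau> \<in> S" "\<And>\<sigma>. \<sigma> \<in> S \<Longrightarrow> \<tau> \<le> \<sigma>"
        using compact_attains_inf[of S] by (auto simp: compact_eq_bounded_closed)
      have \<tau>s: "s \<le> \<tau>" "\<tau> \<le> t" "norm (z \<tau>) = R + 1" using \<tau>(1) by (auto simp: S_def)
      have in_ball: "norm (z \<sigma>) \<le> R + 1" if \<sigma>: "\<sigma> \<in> {s..\<tau>}" for \<sigma>
      proof (rule ccontr)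
        assume "\<not> norm (z \<sigma>) \<le> R + 1"
        then obtain \<sigma>' where "\<sigma>' \<in> S" "\<sigma>' \<le> \<sigma>" using hit[of \<sigma>] \<sigma> \<tau>s by auto
        then have "\<sigma> = \<tau>" using \<tau>(2)[of \<sigma>'] \<sigma> by auto
        then show False using \<open>\<not> norm (z \<sigma>) \<le> R + 1\<close> \<tau>s by simp
      qed
      have sub\<tau>: "{s..\<tau>} \<subseteq> {0..<TF}" "{s..\<tau>} \<subseteq> {0..TF}" "{0..\<tau>} \<subseteq> {0..TF}" using s t \<tau>s by auto
      have "norm (z \<tau> - z s) \<le> integral {s..\<tau>} m"
      proof (rule caratheodory_solution_increment_le[OF z sub\<tau>(1) \<tau>s(1) _ m(2)])
        show "m integrable_on {s..\<tau>}" by (rule integrable_subinterval_real[OF m(1) sub\<tau>(2)])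
        show "norm (F \<sigma> (z \<sigma>)) \<le> m \<sigma>" if "\<sigma> \<in> {s..\<tau>}" "\<sigma> \<notin> N" for \<sigma>
          using in_ball[OF that(1)] sub\<tau>(2) that by (intro m(3)) auto
      qed
      also have "integral {s..\<tau>} m = M \<tau> - M s"
        unfolding M_def
        using Henstock_Kurzweil_Integration.integral_combine[of 0 s \<tau> m] s \<tau>s
          integrable_subinterval_real[OF m(1) sub\<tau>(3)] by simp
      also have "\<dots> < 1"
        using \<delta>(2)[of s] \<delta>(2)[of \<tau>] s \<tau>s t
        by (simp add: dist_real_def abs_if split: if_splits)
      finally have "norm (z \<tau> - z s) < 1" .
      then show False
        using norm_triangle_ineq2[of "z \<tau>" "z s"] \<tau>s(3) zs by linarith
    qed
    \<comment> \<open>After \<open>s\<close> the solution is trapped in the ball, and before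
      \<open>s\<close> it runs over a compact interval, so one compact set contains the whole
      trajectory.\<close>
    have "compact (z ` {0..s} \<union> cball 0 (R + 1))"
      using s by (intro compact_Un compact_continuous_image caratheodory_solution_continuous_on[OF z]) auto
    moreover have "z ` {0..<TF} \<subseteq> z ` {0..s} \<union> cball 0 (R + 1)"
    proof
      fix x assume "x \<in> z ` {0..<TF}"
      then obtain t where "x = z t" "t \<in> {0..<TF}" by blast
      then show "x \<in> z ` {0..s} \<union> cball 0 (R + 1)"
        using stay[of t] by (cases "t \<le> s") auto
    qed
    ultimately show False using blows_up_at_not_bounded[OF F B] by blast
  qed
  then have "R0 \<le> norm (z s)" if "max 0 (TF - \<delta>) < s" "s < TF" for s
    using that unfolding R_def by (meson abs_ge_self less_imp_le order_trans)
  moreover have "max 0 (TF - \<delta>) < TF" using TF \<delta> by simp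
  ultimately show "\<forall>\<^sub>F t in at_left TF. R0 \<le> norm (z t)"
    unfolding eventually_at_left[OF TF] by blast
qed

section \<open>Hamiltonian fields in polar coordinates\<close>

text \<open>By Riesz representation the vector \<open>adjoint f' 1\<close> represents the
  derivative; it is the only one, so \<open>THE\<close> in the definition of \<open>grad\<close> is
  well determined.\<close>

lemma C1_imp_GDERIV_grad:
  fixes f :: "'a::euclidean_space \<Rightarrow> real"
  assumes "C1 f"
  shows "GDERIV f z :> grad f z"
proof -
  obtain f' where f': "(f has_derivative f') (at z)"
    using assms unfolding C1_def differentiable_def by blast
  then have "f' h = h \<bullet> adjoint f' 1" for h
    using adjoint_works[of f' h 1] has_derivative_linear by fastforce
  then have "f' = (\<lambda>h. h \<bullet> adjoint f' 1)" by blast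
  then have D: "GDERIV f z :> adjoint f' 1"
    using f' unfolding gderiv_def by simp
  have "D' = adjoint f' 1" if "GDERIV f z :> D'" for D'
  proof -
    have "(\<lambda>h. h \<bullet> D') = (\<lambda>h. h \<bullet> adjoint f' 1)"
      using has_derivative_unique D that unfolding gderiv_def by blast
    then show ?thesis by (metis inner_commute vector_eq_rdot)
  qed
  then show ?thesis
    unfolding grad_def using D by (metis theI)
qed

lemma J_mult_vec: "J *v x = vector [x $ 2, - x $ 1]"
  by (simp add: J_def vec_eq_iff forall_2 matrix_vector_mult_def sum_2)

text \<open>Since \<open>J\<close> is orthogonal, the numerator of the rotation integrand becomes
  the inner product of the gradient of \<open>H\<close> with \<open>z\<close>.\<close>

lemma inner_J_J: "(J *v x) \<bullet> (J *v y) = x \<bullet> y"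
  by (simp add: J_mult_vec inner_vec_def sum_2)

lemma inner_J_right: "x \<bullet> (J *v y) = - (y \<bullet> (J *v x))"
  by (simp add: J_mult_vec inner_vec_def sum_2)

text \<open>With constant vectors and scalar coefficients, differentiation acts on real functions
  only.\<close>

lemma polar_axis:
  "polar \<theta> \<rho> = (sqrt (2 * \<rho>) * cos \<theta>) *\<^sub>R axis 1 1 - (sqrt (2 * \<rho>) * sin \<theta>) *\<^sub>R axis 2 1"
  by (simp add: polar_def vec_eq_iff forall_2 axis_def)

lemma polar_surj:
  fixes z :: "real^2"
  assumes "z \<noteq> 0"
  obtains \<theta> where "0 \<le> \<theta>" "\<theta> < 2 * pi" "z = polar \<theta> ((norm z)\<^sup>2 / 2)"
proof -
  have n2: "(norm z)\<^sup>2 = (z $ 1)\<^sup>2 + (z $ 2)\<^sup>2"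
    by (simp add: power2_norm_eq_inner inner_vec_def sum_2) (simp add: power2_eq_square)
  have nz: "norm z \<noteq> 0" using assms by simp
  have "(z $ 1 / norm z)\<^sup>2 + (- z $ 2 / norm z)\<^sup>2 = 1"
    using n2[symmetric] nz by (simp only: power_divide add_divide_distrib[symmetric] power2_minus) simp
  then obtain \<theta> where \<theta>: "0 \<le> \<theta>" "\<theta> < 2 * pi" "z $ 1 / norm z = cos \<theta>" "- z $ 2 / norm z = sin \<theta>"
    using sincos_total_2pi by metis
  have "z $ 1 = norm z * cos \<theta>" "z $ 2 = - (norm z * sin \<theta>)"
    unfolding \<theta>(3,4)[symmetric] using nz by auto
  then have "z = polar \<theta> ((norm z)\<^sup>2 / 2)"
    by (simp add: polar_def vec_eq_iff forall_2)
  with that \<theta> show ?thesis by blast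
qed

text \<open>Along a ray the point has velocity \<open>polar \<theta> \<rho>\<close> divided by
  \<open>2 * \<rho>\<close>, because its norm is \<open>sqrt (2 * \<rho>)\<close>; positivity of
  \<open>\<rho>\<close> makes the square root differentiable. As \<open>2 * \<rho>\<close> is the
  squared norm, the result has the shape of the rotation integrand.\<close>

lemma deriv_polar_radial:
  assumes D: "GDERIV h (polar \<theta> \<rho>) :> D" and "\<rho> > 0"
  shows "deriv (\<lambda>\<rho>'. h (polar \<theta> \<rho>')) \<rho> = (D \<bullet> polar \<theta> \<rho>) / (2 * \<rho>)"
proof -
  have pol: "((\<lambda>\<rho>'. polar \<theta> \<rho>') has_vector_derivative (1 / (2 * \<rho>)) *\<^sub>R polar \<theta> \<rho>) (at \<rho>)"
  proof -
    have "((\<lambda>\<rho>'. polar \<theta> \<rho>') has_vector_derivative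
        (1 / sqrt (2 * \<rho>) * cos \<theta>) *\<^sub>R axis 1 1 - (1 / sqrt (2 * \<rho>) * sin \<theta>) *\<^sub>R axis 2 1) (at \<rho>)"
      unfolding polar_axis
      using \<open>\<rho> > 0\<close>
      by (auto intro!: derivative_eq_intros simp: field_simps)
    moreover have "1 / sqrt (2 * \<rho>) = 1 / (2 * \<rho>) * sqrt (2 * \<rho>)"
      using \<open>\<rho> > 0\<close> by (simp add: field_simps)
    ultimately show ?thesis
      by (simp add: polar_axis scaleR_diff_right mult.assoc)
  qed
  have "(h has_derivative (\<lambda>x. x \<bullet> D)) (at (polar \<theta> \<rho>))"
    using D by (simp add: gderiv_def)
  from has_derivative_compose[OF pol[unfolded has_vector_derivative_def] this]
  have "((\<lambda>\<rho>'. h (polar \<theta> \<rho>')) has_real_derivative (D \<bullet> polar \<theta> \<rho>) / (2 * \<rho>)) (at \<rho>)"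
    unfolding has_field_derivative_def
    by (rule has_derivative_eq_rhs) (simp add: fun_eq_iff inner_commute)
  then show ?thesis by (rule DERIV_imp_deriv)
qed

text \<open>For clockwise angles the velocity along the circle is
  \<open>J *v polar \<theta> \<rho>\<close>, with a plus sign.\<close>

lemma deriv_polar_angular:
  assumes D: "GDERIV h (polar \<theta> \<rho>) :> D"
  shows "deriv (\<lambda>\<theta>'. h (polar \<theta>' \<rho>)) \<theta> = D \<bullet> (J *v polar \<theta> \<rho>)"
proof -
  have pol: "((\<lambda>\<theta>'. polar \<theta>' \<rho>) has_vector_derivative J *v polar \<theta> \<rho>) (at \<theta>)"
  proof -
    have "((\<lambda>\<theta>'. polar \<theta>' \<rho>) has_vector_derivative
        (sqrt (2 * \<rho>) * - sin \<theta>) *\<^sub>R axis 1 1 - (sqrt (2 * \<rho>) * cos \<theta>) *\<^sub>R axis 2 1) (at \<theta>)"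
      unfolding polar_axis
      by (auto intro!: derivative_eq_intros simp: mult.commute)
    moreover have "(sqrt (2 * \<rho>) * - sin \<theta>) *\<^sub>R axis 1 1 - (sqrt (2 * \<rho>) * cos \<theta>) *\<^sub>R axis 2 1 = J *v polar \<theta> \<rho>"
      by (simp add: J_mult_vec polar_def vec_eq_iff forall_2 axis_def)
    ultimately show ?thesis by simp
  qed
  have "(h has_derivative (\<lambda>x. x \<bullet> D)) (at (polar \<theta> \<rho>))"
    using D by (simp add: gderiv_def)
  from has_derivative_compose[OF pol[unfolded has_vector_derivative_def] this]
  have "((\<lambda>\<theta>'. h (polar \<theta>' \<rho>)) has_real_derivative D \<bullet> (J *v polar \<theta> \<rho>)) (at \<theta>)"
    by (simp add: has_field_derivative_def inner_commute mult_commute_abs)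
  then show ?thesis by (rule DERIV_imp_deriv)
qed

text \<open>The right-hand side is \<open>\<partial>H/\<partial>\<rho>\<close>, and \<open>z \<bullet> F(t, z) = - \<partial>H/\<partial>\<theta>\<close> is the speed of
  \<open>\<rho>\<close> along trajectories; the power in (H1) is weakened by \<open>x powr \<gamma> \<ge> x - 1\<close>.\<close>

lemma H1_angular_speed_ge:
  assumes "hypothesis_H1 T H" and C1: "\<And>t. C1 (H t)"
  obtains r c where "r > 0" "c > 0"
    "AE t in lebesgue. t \<in> {0..T} \<longrightarrow> (\<forall>z. r \<le> norm z \<longrightarrow>
       c * (z \<bullet> hamiltonian_field H t z - 1) \<le> (hamiltonian_field H t z \<bullet> (J *v z)) / (norm z)\<^sup>2)"
proof -
  obtain r c \<gamma> where rc: "r > 0" "c > 0" "\<gamma> \<ge> 1" and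
    ae: "AE t in lebesgue. t \<in> {0..T} \<longrightarrow>
        (\<forall>\<theta> \<rho>. 0 \<le> \<theta> \<and> \<theta> < 2 * pi \<and> r \<le> \<rho> \<longrightarrow>
           deriv (\<lambda>\<rho>'. H t (polar \<theta> \<rho>')) \<rho>
             \<ge> c * \<bar>deriv (\<lambda>\<theta>'. H t (polar \<theta>' \<rho>)) \<theta>\<bar> powr \<gamma>)"
    using assms(1) unfolding hypothesis_H1_def by blast
  show ?thesis
  \<comment> \<open>(H1) is stated for \<open>\<rho> \<ge> r\<close>, which in terms of the norm
    reads \<open>norm z \<ge> sqrt (2 * r)\<close>.\<close>
  proof (rule that[of "sqrt (2 * r)" c])
    show "sqrt (2 * r) > 0" "c > 0" using rc by auto
    show "AE t in lebesgue. t \<in> {0..T} \<longrightarrow> (\<forall>z. sqrt (2 * r) \<le> norm z \<longrightarrow>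
       c * (z \<bullet> hamiltonian_field H t z - 1) \<le> (hamiltonian_field H t z \<bullet> (J *v z)) / (norm z)\<^sup>2)"
      using ae
    proof (rule AE_mp, intro AE_I2 impI allI)
      fix t and z :: "real^2"
      assume H: "t \<in> {0..T} \<longrightarrow>
        (\<forall>\<theta> \<rho>. 0 \<le> \<theta> \<and> \<theta> < 2 * pi \<and> r \<le> \<rho> \<longrightarrow>
           deriv (\<lambda>\<rho>'. H t (polar \<theta> \<rho>')) \<rho>
             \<ge> c * \<bar>deriv (\<lambda>\<theta>'. H t (polar \<theta>' \<rho>)) \<theta>\<bar> powr \<gamma>)" and t: "t \<in> {0..T}"
        and z: "sqrt (2 * r) \<le> norm z"
      define \<rho> where "\<rho> = (norm z)\<^sup>2 / 2"
      have "2 * r \<le> (norm z)\<^sup>2"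
        using z rc by (metis norm_ge_zero power2_le_imp_le power_mono real_sqrt_ge_zero real_sqrt_pow2 less_imp_le mult_nonneg_nonneg zero_le_numeral)
      then have \<rho>: "r \<le> \<rho>" "\<rho> > 0" using rc by (auto simp: \<rho>_def)
      then have "z \<noteq> 0" by (auto simp: \<rho>_def)
      then obtain \<theta> where \<theta>: "0 \<le> \<theta>" "\<theta> < 2 * pi" "z = polar \<theta> \<rho>"
        using polar_surj unfolding \<rho>_def by metis
      define D where "D = grad (H t) z"
      have D: "GDERIV (H t) (polar \<theta> \<rho>) :> D"
        using C1_imp_GDERIV_grad[OF C1] \<theta>(3) by (simp add: D_def)
      have "c * \<bar>D \<bullet> (J *v z)\<bar> powr \<gamma> \<le> (D \<bullet> z) / (norm z)\<^sup>2"
        using H[rule_format, OF t, of \<theta> \<rho>] \<theta>(1,2) \<rho>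
        unfolding deriv_polar_radial[OF D \<rho>(2)] deriv_polar_angular[OF D] \<theta>(3)[symmetric]
        by (simp add: \<rho>_def)
      moreover have "z \<bullet> hamiltonian_field H t z - 1 \<le> \<bar>D \<bullet> (J *v z)\<bar> powr \<gamma>"
      proof -
        define x where "x = \<bar>D \<bullet> (J *v z)\<bar>"
        have "z \<bullet> hamiltonian_field H t z \<le> x"
          unfolding x_def hamiltonian_field_def D_def[symmetric] using inner_J_right[of z D] by simp
        moreover have "x - 1 \<le> x powr \<gamma>"
        \<comment> \<open>For \<open>x\<close> between 0 and 1 the power may drop below
          \<open>x\<close>; subtracting one makes the left side negative there.\<close>
        proof (cases "x \<ge> 1")
          case True
          then show ?thesis using powr_mono[OF rc(3) True] by simp
        next
          case False
          then show ?thesis using powr_ge_zero[of x \<gamma>] by linarith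
        qed
        ultimately show ?thesis unfolding x_def by linarith
      qed
      ultimately show "c * (z \<bullet> hamiltonian_field H t z - 1) \<le> (hamiltonian_field H t z \<bullet> (J *v z)) / (norm z)\<^sup>2"
        unfolding hamiltonian_field_def[of H t z] inner_J_J D_def[symmetric]
        using rc(2) by (meson mult_left_mono order_trans less_imp_le)
    qed
  qed
qed

section \<open>Rotation along blowing-up solutions\<close>

lemma H0_blows_up_at_nonzero:
  assumes H0: "hypothesis_H0 T H" and B: "blows_up_at (hamiltonian_field H) z TF" and "TF \<le> T"
    and t: "t \<in> {0..<TF}"
  shows "z t \<noteq> 0"
proof
  let ?F = "hamiltonian_field H"
  assume zt: "z t = 0"
  have "t \<in> {0..T}" using t \<open>TF \<le> T\<close> by auto
  then obtain w where w: "caratheodory_solution ?F {0..T} w" "w t = 0"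
    using H0 unfolding hypothesis_H0_def by blast
  have z: "caratheodory_solution ?F {0..<TF} z" using B unfolding blows_up_at_def by blast
  have "caratheodory_solution ?F {0..<TF} w"
    by (rule caratheodory_solution_subset[OF w(1)]) (use \<open>TF \<le> T\<close> in \<open>auto simp: is_interval_co\<close>)
  moreover have "unique_solutions ?F" using H0 unfolding hypothesis_H0_def by blast
  ultimately have "\<forall>s\<in>{0..<TF}. w s = z s"
    using z zt w(2) t unfolding unique_solutions_def by blast
  \<comment> \<open>The inclusion is strict because \<open>TF \<le> T\<close> puts \<open>TF\<close>
    itself into the larger interval; hence \<open>w\<close> would continue \<open>z\<close> beyond
    its maximal interval.\<close>
  moreover have "{0..<TF} \<subset> {0..T}" "{0..T} \<subseteq> {0..}"
  proof -
    have "TF \<in> {0..T}" "TF \<notin> {0..<TF}" "{0..<TF} \<subseteq> {0..T}" using t \<open>TF \<le> T\<close> by auto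
    then show "{0..<TF} \<subset> {0..T}" by blast
  qed auto
  ultimately show False
    using B w(1) unfolding blows_up_at_def by blast
qed

text \<open>The factor multiplying the field is continuous, since \<open>z\<close> does not vanish,
  hence bounded on the compact interval; a bounded measurable factor preserves absolute
  integrability.\<close>

lemma rot_integrand_absolutely_integrable:
  assumes F: "caratheodory F" and z: "caratheodory_solution F I z" "{s..t} \<subseteq> I"
    and nz: "\<And>\<tau>. \<tau> \<in> {s..t} \<Longrightarrow> z \<tau> \<noteq> 0"
  shows "(\<lambda>\<tau>. (F \<tau> (z \<tau>) \<bullet> (J *v z \<tau>)) / (norm (z \<tau>))\<^sup>2) absolutely_integrable_on {s..t}"
proof -
  define \<phi> where "\<phi> \<tau> = (1 / (norm (z \<tau>))\<^sup>2) *\<^sub>R (J *v z \<tau>)" for \<tau>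
  have zc: "continuous_on {s..t} z" by (rule caratheodory_solution_continuous_on[OF z])
  have \<phi>: "continuous_on {s..t} \<phi>"
    unfolding \<phi>_def
    by (intro continuous_intros zc linear_continuous_on_compose[OF zc] matrix_vector_mul_linear) (use nz in auto)
  have "(\<lambda>\<tau>. \<phi> \<tau> \<bullet> F \<tau> (z \<tau>)) absolutely_integrable_on {s..t}"
  proof (rule absolutely_integrable_bounded_measurable_product[where h = "(\<bullet>)" and f = \<phi>])
    show "bilinear ((\<bullet>) :: real^2 \<Rightarrow> real^2 \<Rightarrow> real)"
      by (simp add: bilinear_conv_bounded_bilinear bounded_bilinear_inner)
    show "\<phi> \<in> borel_measurable (lebesgue_on {s..t})"
      by (rule continuous_imp_measurable_on_sets_lebesgue[OF \<phi>]) simp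
    show "bounded (\<phi> ` {s..t})"
      by (intro compact_imp_bounded compact_continuous_image \<phi>) simp
    show "(\<lambda>\<tau>. F \<tau> (z \<tau>)) absolutely_integrable_on {s..t}"
      by (rule caratheodory_solution_absolutely_integrable[OF F z])
  qed simp
  then show ?thesis by (simp add: \<phi>_def inner_commute)
qed

text \<open>The squared norm is Lipschitz on the bounded range of \<open>z\<close>, so it inherits
  absolute continuity from \<open>z\<close> and equals the integral of its derivative, given by the
  product rule.\<close>

lemma caratheodory_solution_norm_square_has_integral:
  assumes z: "caratheodory_solution F I z" "{s..t} \<subseteq> I" "s \<le> t"
  shows "((\<lambda>\<tau>. z \<tau> \<bullet> F \<tau> (z \<tau>)) has_integral ((norm (z t))\<^sup>2 / 2 - (norm (z s))\<^sup>2 / 2)) {s..t}"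
proof -
  define \<rho> where "\<rho> \<tau> = (z \<tau> \<bullet> z \<tau>) / 2" for \<tau>
  have "compact (z ` {s..t})"
    by (intro compact_continuous_image caratheodory_solution_continuous_on[OF z(1,2)]) simp
  then have "bounded (z ` {s..t})" by (rule compact_imp_bounded)
  then obtain B where B: "\<And>\<tau>. \<tau> \<in> {s..t} \<Longrightarrow> norm (z \<tau>) \<le> B"
    unfolding bounded_iff by (metis image_eqI)
  have "absolutely_continuous_on {s..t} z"
    using z unfolding caratheodory_solution_def by blast
  then have "absolutely_continuous_on {s..t} \<rho>"
  proof (rule absolutely_continuous_on_Lipschitz)
    fix u v assume uv: "u \<in> {s..t}" "v \<in> {s..t}"
    have "\<rho> v - \<rho> u = ((z v + z u) \<bullet> (z v - z u)) / 2"
      by (simp add: \<rho>_def inner_diff_right inner_add_left inner_commute[of "z u" "z v"])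
    then have "norm (\<rho> v - \<rho> u) = \<bar>(z v + z u) \<bullet> (z v - z u)\<bar> / 2"
      by (simp only: real_norm_def abs_divide abs_numeral)
    also have "\<dots> \<le> norm (z v + z u) * norm (z v - z u) / 2"
      using Cauchy_Schwarz_ineq2[of "z v + z u" "z v - z u"] by simp
    also have "\<dots> \<le> (2 * B) * norm (z v - z u) / 2"
      using norm_triangle_ineq[of "z v" "z u"] B[OF uv(1)] B[OF uv(2)]
      by (intro divide_right_mono mult_right_mono) auto
    finally show "norm (\<rho> v - \<rho> u) \<le> B * norm (z v - z u)" by simp
  qed
  moreover have "AE \<tau> in lebesgue. \<tau> \<in> {s..t} \<longrightarrow>
      (\<rho> has_vector_derivative z \<tau> \<bullet> F \<tau> (z \<tau>)) (at \<tau> within {s..t})"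
  proof -
    have "AE \<tau> in lebesgue. \<tau> \<in> I \<longrightarrow> (z has_vector_derivative F \<tau> (z \<tau>)) (at \<tau> within I)"
      using z unfolding caratheodory_solution_def by blast
    then show ?thesis
    proof (eventually_elim, intro impI)
      fix \<tau> assume "\<tau> \<in> I \<longrightarrow> (z has_vector_derivative F \<tau> (z \<tau>)) (at \<tau> within I)" "\<tau> \<in> {s..t}"
      then have "(z has_vector_derivative F \<tau> (z \<tau>)) (at \<tau> within {s..t})"
        using z(2) has_vector_derivative_within_subset by blast
      then have "((\<lambda>\<tau>. z \<tau> \<bullet> z \<tau>) has_vector_derivative z \<tau> \<bullet> F \<tau> (z \<tau>) + F \<tau> (z \<tau>) \<bullet> z \<tau>) (at \<tau> within {s..t})"
        by (intro bounded_bilinear.has_vector_derivative[OF bounded_bilinear_inner])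
      from has_vector_derivative_divide[OF this, of 2]
      show "(\<rho> has_vector_derivative z \<tau> \<bullet> F \<tau> (z \<tau>)) (at \<tau> within {s..t})"
        unfolding \<rho>_def by (simp add: inner_commute)
    qed
  qed
  ultimately have "((\<lambda>\<tau>. z \<tau> \<bullet> F \<tau> (z \<tau>)) has_integral (\<rho> t - \<rho> s)) {s..t}"
    by (rule has_integral_absolutely_continuous_on[OF z(3)])
  then show ?thesis by (simp add: \<rho>_def power2_norm_eq_inner)
qed

theorem lemma5p3:
  fixes T :: real and H :: "real \<Rightarrow> real^2 \<Rightarrow> real"
  assumes "T > 0"
    and "hypothesis_H0 T H"
    and "hypothesis_H1 T H"
  shows "\<forall>z0 z TF. z 0 = z0 \<and> TF \<in> {0<..T} \<and> blows_up_at (hamiltonian_field H) z TF \<longrightarrow>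
           filterlim (rot (hamiltonian_field H) z) at_top (at_left TF)"
proof (intro allI impI)
  fix z0 z TF
  assume "z 0 = z0 \<and> TF \<in> {0<..T} \<and> blows_up_at (hamiltonian_field H) z TF"
  then have TF: "0 < TF" "TF \<le> T" and B: "blows_up_at (hamiltonian_field H) z TF" by auto
  define F where "F = hamiltonian_field H"
  have F: "caratheodory F" and C1: "\<And>t. C1 (H t)"
    using assms(2) unfolding hypothesis_H0_def F_def by auto
  have z: "caratheodory_solution F {0..<TF} z"
    using B unfolding blows_up_at_def F_def by blast
  have nz: "z t \<noteq> 0" if "t \<in> {0..<TF}" for t
    by (rule H0_blows_up_at_nonzero[OF assms(2) B TF(2) that])
  have norm_top: "filterlim (\<lambda>t. norm (z t)) at_top (at_left TF)"
    by (rule blows_up_at_norm_at_top[OF F B[folded F_def]])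
  obtain r c where rc: "r > 0" "c > 0"
    and ae: "AE t in lebesgue. t \<in> {0..T} \<longrightarrow> (\<forall>x. r \<le> norm x \<longrightarrow>
       c * (x \<bullet> F t x - 1) \<le> (F t x \<bullet> (J *v x)) / (norm x)\<^sup>2)"
    using H1_angular_speed_ge[OF assms(3) C1] unfolding F_def by blast
  obtain t0 where t0: "t0 < TF" "\<And>t. t0 < t \<Longrightarrow> t < TF \<Longrightarrow> r \<le> norm (z t)"
    using norm_top[unfolded filterlim_at_top, rule_format, of r]
    unfolding eventually_at_left[OF TF(1)] by blast
  \<comment> \<open>The midpoint lies strictly after both 0 and \<open>t0\<close> and strictly
    before \<open>TF\<close>. The rotation up to \<open>s\<close> is a fixed number, and from
    \<open>s\<close> on the norm is large enough for (H1).\<close>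
  define s where "s = (max 0 t0 + TF) / 2"
  have s: "0 \<le> s" "s < TF" "t0 < s" using t0(1) TF(1) by (auto simp: s_def)
  define g where "g t = (F t (z t) \<bullet> (J *v z t)) / (norm (z t))\<^sup>2" for t
  have g: "g absolutely_integrable_on {u..v}" if "{u..v} \<subseteq> {0..<TF}" for u v
    unfolding g_def by (rule rot_integrand_absolutely_integrable[OF F z that]) (use that nz in blast)
  define \<rho> where "\<rho> t = (norm (z t))\<^sup>2 / 2" for t
  have low: "1 / (2 * pi) * (integral {0..s} g + c * (\<rho> t - \<rho> s - (t - s))) \<le> rot F z t"
    if t: "s \<le> t" "t < TF" for t
  proof -
    have sub: "{s..t} \<subseteq> {0..<TF}" "{0..t} \<subseteq> {0..<TF}" using s t by auto
    note gi = g[THEN set_lebesgue_integral_eq_integral(1)]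
    have "((\<lambda>\<tau>. z \<tau> \<bullet> F \<tau> (z \<tau>)) has_integral (\<rho> t - \<rho> s)) {s..t}"
      using caratheodory_solution_norm_square_has_integral[OF z sub(1) t(1)] by (simp add: \<rho>_def)
    moreover have "((\<lambda>\<tau>. 1) has_integral (t - s)) {s..t}"
      using has_integral_const_real[of "1::real" s t] t(1) by simp
    ultimately have lower:
      "((\<lambda>\<tau>. c * (z \<tau> \<bullet> F \<tau> (z \<tau>) - 1)) has_integral c * (\<rho> t - \<rho> s - (t - s))) {s..t}"
      by (intro has_integral_mult_right has_integral_diff)
    obtain N where N: "negligible N" "\<And>\<tau>. \<tau> \<in> {s..t} - N \<Longrightarrow> c * (z \<tau> \<bullet> F \<tau> (z \<tau>) - 1) \<le> g \<tau>"
    proof -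
      obtain N where "negligible N" and N: "\<And>\<tau> x. \<tau> \<notin> N \<Longrightarrow> \<tau> \<in> {0..T} \<Longrightarrow> r \<le> norm x \<Longrightarrow>
         c * (x \<bullet> F \<tau> x - 1) \<le> (F \<tau> x \<bullet> (J *v x)) / (norm x)\<^sup>2"
        using ae unfolding eventually_ae_filter_negligible by blast
      show ?thesis
      proof (rule that[OF \<open>negligible N\<close>])
        fix \<tau> assume "\<tau> \<in> {s..t} - N"
        then show "c * (z \<tau> \<bullet> F \<tau> (z \<tau>) - 1) \<le> g \<tau>"
          unfolding g_def using s t TF(2) by (intro N t0(2)) auto
      qed
    qed
    have "c * (\<rho> t - \<rho> s - (t - s)) \<le> integral {s..t} g"
    proof -
      \<comment> \<open>On \<open>N\<close> the lower bound is replaced by \<open>g\<close> itself,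
        so the comparison of integrals holds pointwise.\<close>
      have "((\<lambda>\<tau>. if \<tau> \<in> N then g \<tau> else c * (z \<tau> \<bullet> F \<tau> (z \<tau>) - 1)) has_integral c * (\<rho> t - \<rho> s - (t - s))) {s..t}"
        by (rule has_integral_spike[OF N(1) _ lower]) simp
      then show ?thesis
        by (rule has_integral_le[OF _ integrable_integral[OF gi[OF sub(1)]]]) (use N(2) in auto)
    qed
    moreover have "integral {0..s} g + integral {s..t} g = integral {0..t} g"
      by (rule Henstock_Kurzweil_Integration.integral_combine) (use s t gi[OF sub(2)] in auto)
    \<comment> \<open>The rotation is a Lebesgue integral; absolute integrability identifies it with
      the gauge integral, which was split at \<open>s\<close>.\<close>
    moreover have "rot F z t = 1 / (2 * pi) * integral {0..t} g"
      unfolding rot_def g_def[symmetric] set_lebesgue_integral_eq_integral(2)[OF g[OF sub(2)]] ..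
    ultimately show ?thesis by (simp add: divide_right_mono)
  qed
  have "filterlim (\<lambda>t. 1 / (2 * pi) * (integral {0..s} g + c * (\<rho> t - \<rho> s - (t - s)))) at_top (at_left TF)"
  proof -
    have "filterlim (\<lambda>t. (norm (z t))\<^sup>2) at_top (at_left TF)"
      by (rule filterlim_pow_at_top[OF _ norm_top]) simp
    then have "filterlim \<rho> at_top (at_left TF)"
      using filterlim_tendsto_pos_mult_at_top[of "\<lambda>_. 1/2" "1/2"] unfolding \<rho>_def by simp
    \<comment> \<open>Only \<open>\<rho> t\<close> is unbounded; the remaining terms converge as
      \<open>t\<close> tends to \<open>TF\<close>.\<close>
    then have "filterlim (\<lambda>t. (- \<rho> s - (t - s)) + \<rho> t) at_top (at_left TF)"
      by (rule filterlim_tendsto_add_at_top[rotated]) (rule tendsto_intros)+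
    then have "filterlim (\<lambda>t. c * ((- \<rho> s - (t - s)) + \<rho> t)) at_top (at_left TF)"
      by (rule filterlim_tendsto_pos_mult_at_top[OF tendsto_const rc(2)])
    then have "filterlim (\<lambda>t. integral {0..s} g + c * ((- \<rho> s - (t - s)) + \<rho> t)) at_top (at_left TF)"
      by (rule filterlim_tendsto_add_at_top[OF tendsto_const])
    then have "filterlim (\<lambda>t. 1 / (2 * pi) * (integral {0..s} g + c * ((- \<rho> s - (t - s)) + \<rho> t))) at_top (at_left TF)"
      by (rule filterlim_tendsto_pos_mult_at_top[OF tendsto_const, rotated]) simp
    then show ?thesis by (simp add: algebra_simps)
  qed
  moreover have "\<forall>\<^sub>F t in at_left TF. 1 / (2 * pi) * (integral {0..s} g + c * (\<rho> t - \<rho> s - (t - s))) \<le> rot F z t"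
    unfolding eventually_at_left[OF s(2)] using low s(2) by (intro exI[of _ s]) auto
  ultimately show "filterlim (rot (hamiltonian_field H) z) at_top (at_left TF)"
    unfolding F_def[symmetric] by (rule filterlim_at_top_mono)
qed

end
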